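(* Let $\mathbf{T}=(T(t))_{t\ge0}$ be a semigroup of type $(M,\omega)$ on the norming dual pair $(X,Y)$. The following are equivalent: (i) $\mathbf{T}$ is an integrable semigroup; (ii) for every $x\in X$ the orbit $t\mapsto T(t)x$ is locally $Y$-integrable, and for every $y\in Y$ the orbit $t\mapsto T(t)'y$ is locally $X$-integrable.
   Context: A norming dual pair $(X,Y)$ consists of nontrivial (complex) Banach spaces $X,Y$ and a duality pairing (bilinear form) $\langle\cdot,\cdot\rangle:X\times Y\to\mathbb{C}$ such that $\|x\|_X=\sup\{|\langle x,y\rangle|: y\in Y,\|y\|_Y\le1\}$ for all $x\in X$ and $\|y\|_Y=\sup\{|\langle x,y\rangle|: x\in X,\|x\|_X\le1\}$ for all $y\in Y$. Then $(Y,X)$ is also a norming dual pair. Via the pairing, $X\subset Y^*$ and $Y\subset X^*$ as closed, isometrically embedded subspaces. Write $\sigma=\sigma(X,Y)$, and $L(X,\sigma)$ for the algebra of $\sigma$-continuous linear operators on $X$ (automatically norm bounded). For $T\in L(X,\sigma)$, $T'$ denotes the $\sigma$-adjoint, i.e. the operator on $Y$ with $\langle Tx,y\rangle=\langle x,T'y\rangle$ for all $x\in X,y\in Y$. A semigroup on $(X,Y)$ is a family $\mathbf{T}=(T(t))_{t\ge0}\subset L(X,\sigma)$ with $T(t+s)=T(t)T(s)$ for all $t,s\ge0$ and $T(0)=\mathrm{id}_X$. It is of type $(M,\omega)$, where $M\ge1$ and $\omega\in\mathbb{R}$, if $\|T(t)\|\le Me^{\omega t}$ for all $t\ge0$. A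 semigroup of type $(M,\omega)$ is integrable if $t\mapsto\langle T(t)x,y\rangle$ is measurable for all $x\in X,y\in Y$ and there exist a complex number $\lambda_0$ with $\mathrm{Re}\,\lambda_0>\omega$ and an operator $R_0\in L(X,\sigma)$ such that $\langle R_0x,y\rangle=\int_0^\infty e^{-\lambda_0t}\langle T(t)x,y\rangle\,dt$ for all $x\in X,y\in Y$. For a $\sigma$-finite measure space $(\Omega,\mathscr{F},m)$, a function $f:\Omega\to X$ is scalarly $Y$-integrable if $\omega\mapsto\langle f(\omega),y\rangle$ is integrable for every $y\in Y$; then, for $A\in\mathscr{F}$, the $Y$-integral $\int_A f\,dm\in Y^*$ is the continuous functional $y\mapsto\int_A\langle f,y\rangle\,dm$. $f$ is $Y$-integrable if it is scalarly $Y$-integrable and $\int_A f\,dm\in X\subset Y^*$ for every $A\in\mathscr{F}$. $X$-integrability of $Y$-valued functions is defined by exchanging the roles of $X$ and $Y$. "Local" $Y$- (resp. $X$-) integrability of a function on $[0,\infty)$ means $Y$- (resp. $X$-) integrability on every bounded interval in $[0,\infty)$ with respect to Lebesgue measure. *)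

theory Defs
  imports "HOL-Analysis.Analysis"
begin

text \<open>Complex normed and Banach spaces. The library's \<open>banach\<close> class is over the reals; the
  complex structure is added as an operation extending \<open>scaleR\<close>.\<close>

class complex_normed_vector = real_normed_vector +
  fixes scaleC :: "complex \<Rightarrow> 'a \<Rightarrow> 'a"  (infixr \<open>*\<^sub>C\<close> 75)
  assumes scaleC_add_right: "a *\<^sub>C (x + y) = a *\<^sub>C x + a *\<^sub>C y"
    and scaleC_add_left: "(a + b) *\<^sub>C x = a *\<^sub>C x + b *\<^sub>C x"
    and scaleC_scaleC: "a *\<^sub>C b *\<^sub>C x = (a * b) *\<^sub>C x"
    and scaleC_of_real: "complex_of_real r *\<^sub>C x = r *\<^sub>R x"
    and norm_scaleC: "norm (a *\<^sub>C x) = cmod a * norm x"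

class complex_banach = complex_normed_vector + banach

instantiation complex :: complex_banach
begin

definition scaleC_complex :: "complex \<Rightarrow> complex \<Rightarrow> complex"
  where "scaleC_complex a x = a * x"

instance
  by standard
    (simp_all only: scaleC_complex_def distrib_left distrib_right mult.assoc norm_mult scaleR_conv_of_real)

end

lemma vector_space_scaleC:
  "vector_space (scaleC :: complex \<Rightarrow> 'a \<Rightarrow> 'a::complex_normed_vector)"
proof
  show "1 *\<^sub>C x = x" for x :: 'a
    using scaleC_of_real[of 1 x] by simp
qed (simp_all add: scaleC_add_right scaleC_add_left scaleC_scaleC)

abbreviation clinear :: "('a::complex_normed_vector \<Rightarrow> 'b::complex_normed_vector) \<Rightarrow> bool"
  where "clinear \<equiv> Vector_Spaces.linear scaleC scaleC"


text \<open>The suprema are taken in the extended reals, so that they are genuine suprema without any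
  prior boundedness assumption on the pairing.\<close>

locale norming_dual_pair =
  fixes pairing :: "'a::complex_banach \<Rightarrow> 'b::complex_banach \<Rightarrow> complex"
  assumes nontrivial_left: "\<exists>x::'a. x \<noteq> 0"
    and nontrivial_right: "\<exists>y::'b. y \<noteq> 0"
    and linear_left: "\<And>y. clinear (\<lambda>x. pairing x y)"
    and linear_right: "\<And>x. clinear (\<lambda>y. pairing x y)"
    and norming_left: "\<And>x. ereal (norm x) = (SUP y\<in>{y. norm y \<le> 1}. ereal (cmod (pairing x y)))"
    and norming_right: "\<And>y. ereal (norm y) = (SUP x\<in>{x. norm x \<le> 1}. ereal (cmod (pairing x y)))"

abbreviation (input) flip :: "('a \<Rightarrow> 'b \<Rightarrow> complex) \<Rightarrow> 'b \<Rightarrow> 'a \<Rightarrow> complex"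
  where "flip p \<equiv> (\<lambda>y x. p x y)"

lemma norming_dual_pair_flip:
  assumes "norming_dual_pair p"
  shows "norming_dual_pair (flip p)"
proof -
  interpret norming_dual_pair p by (fact assms)
  show ?thesis
    by (rule norming_dual_pair.intro)
      (fact nontrivial_right nontrivial_left linear_right linear_left norming_right norming_left)+
qed

text \<open>\<open>\<sigma>(X,Y)\<close>: the coarsest topology making all functionals \<open>\<langle>\<cdot>,y\<rangle>\<close> continuous.\<close>

definition sigma_topology :: "('a \<Rightarrow> 'b \<Rightarrow> complex) \<Rightarrow> 'a topology"
  where "sigma_topology p = topology_generated_by {(\<lambda>x. p x y) -` U | y U. open U}"

definition sigma_operators ::
    "('a::complex_banach \<Rightarrow> 'b::complex_banach \<Rightarrow> complex) \<Rightarrow> ('a \<Rightarrow> 'a) set"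
  where "sigma_operators p =
    {T. clinear T \<and> continuous_map (sigma_topology p) (sigma_topology p) T}"

text \<open>On a norming dual pair the adjoint of a \<open>\<sigma>\<close>-continuous linear operator exists and is unique.\<close>

definition sigma_adjoint :: "('a \<Rightarrow> 'b \<Rightarrow> complex) \<Rightarrow> ('a \<Rightarrow> 'a) \<Rightarrow> 'b \<Rightarrow> 'b"
  where "sigma_adjoint p T = (THE S. \<forall>x y. p (T x) y = p x (S y))"

text \<open>Families indexed by \<open>t \<ge> 0\<close> are functions on all of \<^typ>\<open>real\<close> whose values at negative
  arguments are never used.\<close>

definition semigroup_on ::
    "('a::complex_banach \<Rightarrow> 'b::complex_banach \<Rightarrow> complex) \<Rightarrow> (real \<Rightarrow> 'a \<Rightarrow> 'a) \<Rightarrow> bool"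
  where "semigroup_on p T \<longleftrightarrow>
    (\<forall>t\<ge>0. T t \<in> sigma_operators p) \<and>
    (\<forall>t\<ge>0. \<forall>s\<ge>0. T (t + s) = T t \<circ> T s) \<and>
    T 0 = id"

text \<open>\<open>bounded_linear (T t)\<close> is automatic for \<open>\<sigma>\<close>-continuous \<open>T t\<close>; it is spelled out because
  \<^const>\<open>onorm\<close> is meaningful for bounded operators only.\<close>

definition semigroup_of_type ::
    "('a::complex_banach \<Rightarrow> 'b::complex_banach \<Rightarrow> complex) \<Rightarrow> real \<Rightarrow> real
      \<Rightarrow> (real \<Rightarrow> 'a \<Rightarrow> 'a) \<Rightarrow> bool"
  where "semigroup_of_type p M \<omega> T \<longleftrightarrow>
    semigroup_on p T \<and> M \<ge> 1 \<and>
    (\<forall>t\<ge>0. bounded_linear (T t) \<and> onorm (T t) \<le> M * exp (\<omega> * t))"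

text \<open>For a semigroup of type \<open>(M, \<omega>)\<close> with measurable orbits and \<open>Re \<mu> > \<omega>\<close> the Laplace integral
  converges absolutely.\<close>

definition integrable_semigroup ::
    "('a::complex_banach \<Rightarrow> 'b::complex_banach \<Rightarrow> complex) \<Rightarrow> real
      \<Rightarrow> (real \<Rightarrow> 'a \<Rightarrow> 'a) \<Rightarrow> bool"
  where "integrable_semigroup p \<omega> T \<longleftrightarrow>
    (\<forall>x y. (\<lambda>t. p (T t x) y) \<in> borel_measurable (lebesgue_on {0..})) \<and>
    (\<exists>\<mu> R\<^sub>0. Re \<mu> > \<omega> \<and> R\<^sub>0 \<in> sigma_operators p \<and>
      (\<forall>x y. p (R\<^sub>0 x) y =
        (LINT t|lebesgue_on {0..}. exp (- \<mu> * complex_of_real t) * p (T t x) y)))"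

definition scalarly_integrable ::
    "('a \<Rightarrow> 'b \<Rightarrow> complex) \<Rightarrow> 'm measure \<Rightarrow> ('m \<Rightarrow> 'a) \<Rightarrow> bool"
  where "scalarly_integrable p m f \<longleftrightarrow> (\<forall>y. integrable m (\<lambda>w. p (f w) y))"

definition weak_integral ::
    "('a \<Rightarrow> 'b \<Rightarrow> complex) \<Rightarrow> 'm measure \<Rightarrow> 'm set \<Rightarrow> ('m \<Rightarrow> 'a) \<Rightarrow> 'b \<Rightarrow> complex"
  where "weak_integral p m A f = (\<lambda>y. LINT w:A|m. p (f w) y)"

text \<open>\<open>Y\<close>-integrability for \<open>p = \<langle>\<cdot>,\<cdot>\<rangle>\<close>; \<open>X\<close>-integrability for \<open>flip p\<close>. The range of the curried
  pairing is the copy of \<open>X\<close> inside the dual of \<open>Y\<close>.\<close>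

definition pair_integrable ::
    "('a \<Rightarrow> 'b \<Rightarrow> complex) \<Rightarrow> 'm measure \<Rightarrow> ('m \<Rightarrow> 'a) \<Rightarrow> bool"
  where "pair_integrable p m f \<longleftrightarrow>
    scalarly_integrable p m f \<and> (\<forall>A\<in>sets m. weak_integral p m A f \<in> range p)"

definition locally_pair_integrable ::
    "('a \<Rightarrow> 'b \<Rightarrow> complex) \<Rightarrow> (real \<Rightarrow> 'a) \<Rightarrow> bool"
  where "locally_pair_integrable p f \<longleftrightarrow>
    (\<forall>J. is_interval J \<and> bounded J \<and> J \<subseteq> {0..} \<longrightarrow> pair_integrable p (lebesgue_on J) f)"

end

theory Submission
  imports Defs
begin

text \<open>For a measurable scalar function \<open>f\<close> call \<open>\<integral> f(t) T(t)x dt\<close> represented if it lies in \<open>X\<close>; as \<open>X\<close> is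
  norm closed in the dual of \<open>Y\<close>, the represented \<open>f\<close> are closed under dominated limits. If the orbits are
  locally integrable, then \<open>f(t) = exp (-\<mu>t)\<close> is represented for every \<open>Re \<mu> > \<omega>\<close>, both for \<open>T\<close> and for
  the adjoint semigroup, and the two resulting Laplace transforms are adjoint to each other, which makes
  them \<open>\<sigma>\<close>-continuous.

  Conversely, let the Laplace transform \<open>R\<close> at \<open>\<mu>\<close> take values in \<open>X\<close>. For small \<open>d > 0\<close> the operator
  \<open>I + dR\<close> is onto by a Neumann series argument, and the resolvent identity identifies the Laplace transform
  of \<open>z + dRz\<close> at \<open>\<mu> + d\<close> with \<open>Rz\<close>. Since the same \<open>d\<close> works at \<open>\<mu> + d\<close>, all \<open>exp (-(\<mu> + kd)t)\<close> are
  represented. By Weierstrass approximation in \<open>s = exp (-dt)\<close> so are all continuous functions with bounded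
  support, and then all indicators of bounded measurable sets. The \<open>\<sigma>\<close>-adjoint of \<open>R\<close> provides the same
  for the adjoint semigroup.\<close>

section \<open>Adjoints on a norming dual pair\<close>

lemma clinearD:
  assumes "clinear f"
  shows "f (x + y) = f x + f y" "f (c *\<^sub>C x) = c *\<^sub>C f x" "f (x - y) = f x - f y" "f 0 = 0"
proof -
  interpret Vector_Spaces.linear scaleC scaleC f by (fact assms)
  show "f (x + y) = f x + f y" "f (c *\<^sub>C x) = c *\<^sub>C f x" "f (x - y) = f x - f y" "f 0 = 0"
    by (fact add scale diff zero)+
qed

lemma clinearI:
  fixes f :: "'a::complex_normed_vector \<Rightarrow> 'b::complex_normed_vector"
  assumes "\<And>x y. f (x + y) = f x + f y" "\<And>c x. f (c *\<^sub>C x) = c *\<^sub>C f x"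
  shows "clinear f"
proof -
  interpret domain: vector_space "scaleC :: complex \<Rightarrow> 'a \<Rightarrow> 'a" by (rule vector_space_scaleC)
  interpret codomain: vector_space "scaleC :: complex \<Rightarrow> 'b \<Rightarrow> 'b" by (rule vector_space_scaleC)
  show ?thesis by unfold_locales (fact assms)+
qed

lemma scaleC_complex [simp]: "(c::complex) *\<^sub>C z = c * z"
  by (simp add: scaleC_complex_def)

context norming_dual_pair
begin

lemma flip_pair: "norming_dual_pair (flip pairing)"
  by (rule norming_dual_pair_flip) unfold_locales

lemmas left_simps = clinearD[OF linear_left]
lemmas right_simps = clinearD[OF linear_right]

lemma cmod_pairing_le: "cmod (pairing x y) \<le> norm x * norm y"
proof (cases "y = 0")
  case True
  then show ?thesis by (simp add: right_simps)
next
  case False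
  define c where "c = complex_of_real (inverse (norm y))"
  have "norm (c *\<^sub>C y) \<le> 1"
    using False by (simp add: norm_scaleC c_def norm_inverse)
  then have "ereal (cmod (pairing x (c *\<^sub>C y))) \<le> (SUP y\<in>{y. norm y \<le> 1}. ereal (cmod (pairing x y)))"
    by (intro SUP_upper) auto
  then have "cmod (pairing x (c *\<^sub>C y)) \<le> norm x"
    by (simp flip: norming_left)
  then show ?thesis
    using False by (simp add: right_simps norm_mult norm_divide c_def norm_inverse field_simps)
qed

lemma norm_le_pairingI:
  assumes "0 \<le> B" "\<And>y. cmod (pairing x y) \<le> B * norm y"
  shows "norm x \<le> B"
proof -
  have "cmod (pairing x y) \<le> B" if "norm y \<le> 1" for y
    using assms(2)[of y] mult_left_mono[OF that assms(1)] by simp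
  then have "ereal (norm x) \<le> ereal B"
    unfolding norming_left by (intro SUP_least) auto
  then show ?thesis by simp
qed

lemma pairing_eqI:
  assumes "\<And>y. pairing x y = pairing x' y"
  shows "x = x'"
  using norm_le_pairingI[of 0 "x - x'"] assms by (simp add: left_simps)

lemma tendsto_pairing: "u \<longlonglongrightarrow> l \<Longrightarrow> (\<lambda>n. pairing (u n) y) \<longlonglongrightarrow> pairing l y"
proof (rule metric_tendsto_imp_tendsto[where f = "\<lambda>n. norm (u n - l) * norm y" and a = 0])
  assume "u \<longlonglongrightarrow> l"
  then show "(\<lambda>n. norm (u n - l) * norm y) \<longlonglongrightarrow> 0"
    by (intro tendsto_mult_left_zero tendsto_norm_zero) (simp add: LIM_zero)
  show "\<forall>\<^sub>F n in sequentially. dist (pairing (u n) y) (pairing l y) \<le> dist (norm (u n - l) * norm y) 0"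
    by (intro always_eventually allI) (simp add: dist_norm cmod_pairing_le flip: left_simps(3))
qed

section \<open>Functionals and operators continuous for the weak topology\<close>

text \<open>Linear algebra behind the identification of the \<sigma>-dual of X with Y: a functional
  vanishing on the common kernel of finitely many elements of Y is a combination of them. The
  induction splits off \<open>y0\<close> by subtracting a multiple of its functional.\<close>

lemma functional_eq_pairing:
  assumes "finite F" "clinear \<phi>" "\<And>x. (\<And>y. y \<in> F \<Longrightarrow> pairing x y = 0) \<Longrightarrow> \<phi> x = 0"
  shows "\<exists>y'. \<forall>x. \<phi> x = pairing x y'"
  using assms
proof (induction F arbitrary: \<phi> rule: finite_induct)
  case empty
  then show ?case by (intro exI[of _ 0]) (simp add: right_simps)
next
  case (insert y0 F)
  note lin = clinearD[OF insert.prems(1)]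
  show ?case
  proof (cases "\<exists>x0. (\<forall>y\<in>F. pairing x0 y = 0) \<and> pairing x0 y0 \<noteq> 0")
    \<comment> \<open>Here \<open>y0\<close> vanishes wherever all of \<open>F\<close> does, so
      \<open>F\<close> alone controls \<open>\<phi>\<close>.\<close>
    case False
    show ?thesis
    proof (rule insert.IH[OF insert.prems(1)])
      show "\<phi> x = 0" if "\<And>y. y \<in> F \<Longrightarrow> pairing x y = 0" for x
        using that False by (intro insert.prems(2)) blast
    qed
  next
    case True
    then obtain x0 where x0: "\<And>y. y \<in> F \<Longrightarrow> pairing x0 y = 0" "pairing x0 y0 \<noteq> 0"
      by blast
    \<comment> \<open>The only multiple of \<open>y0\<close> that makes the difference vanish at
      \<open>x0\<close>.\<close>
    define c where "c = \<phi> x0 / pairing x0 y0"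
    have "\<exists>y'. \<forall>x. \<phi> x - c * pairing x y0 = pairing x y'"
    proof (rule insert.IH)
      show "clinear (\<lambda>x. \<phi> x - c * pairing x y0)"
        by (rule clinearI) (simp_all add: lin left_simps algebra_simps)
      show "\<phi> x - c * pairing x y0 = 0" if "\<And>y. y \<in> F \<Longrightarrow> pairing x y = 0" for x
      proof -
        \<comment> \<open>Correcting \<open>x\<close> along \<open>x0\<close> makes its pairing with
          \<open>y0\<close> vanish and leaves the pairings with \<open>F\<close> at zero.\<close>
        let ?x = "x - (pairing x y0 / pairing x0 y0) *\<^sub>C x0"
        have "\<phi> ?x = 0"
          using that x0 by (intro insert.prems(2)) (auto simp: left_simps)
        then show ?thesis by (simp add: lin c_def)
      qed
    qed
    then obtain y' where "\<And>x. \<phi> x - c * pairing x y0 = pairing x y'" by blast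
    then have "\<phi> x = pairing x (y' + c *\<^sub>C y0)" for x
      by (metis right_simps(1,2) scaleC_complex diff_add_cancel)
    then show ?thesis by blast
  qed
qed

text \<open>Each generator looks at one element of Y, and finite intersections at finitely many, so
  near \<open>x0\<close> a \<sigma>-open set restricts only finitely many pairings. The affine
  subspace inside the neighbourhood is what the scaling argument for adjoints uses.\<close>

lemma sigma_open_contains_annihilator:
  assumes "openin (sigma_topology pairing) W" "x0 \<in> W"
  shows "\<exists>F. finite F \<and> {x. \<forall>y\<in>F. pairing x y = pairing x0 y} \<subseteq> W"
proof -
  have "generate_topology_on {(\<lambda>x. pairing x y) -` U | y U. open U} W"
    using assms(1) by (simp add: sigma_topology_def openin_topology_generated_by_iff)
  then show ?thesis using assms(2)
  proof induction
    case (Int a b)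
    then obtain F G where "finite F" "{x. \<forall>y\<in>F. pairing x y = pairing x0 y} \<subseteq> a"
      "finite G" "{x. \<forall>y\<in>G. pairing x y = pairing x0 y} \<subseteq> b" by auto
    then show ?case by (intro exI[of _ "F \<union> G"]) blast
  next
    case (UN K)
    then obtain k where "k \<in> K" "x0 \<in> k" by blast
    with UN.IH obtain F where "finite F" "{x. \<forall>y\<in>F. pairing x y = pairing x0 y} \<subseteq> k" by meson
    with \<open>k \<in> K\<close> show ?case by (meson Union_upper subset_trans)
  next
    case (Basis s)
    then obtain y U where s: "s = (\<lambda>x. pairing x y) -` U" by blast
    have "{x. \<forall>y\<in>{y}. pairing x y = pairing x0 y} \<subseteq> s"
      using Basis.prems by (auto simp: s)
    then show ?case by (meson finite.emptyI finite.insertI)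
  qed simp
qed

lemma topspace_sigma: "topspace (sigma_topology pairing) = UNIV"
proof -
  have "(\<lambda>x. pairing x undefined) -` UNIV \<in> {(\<lambda>x. pairing x y) -` U | y U. open U}" by blast
  then show ?thesis unfolding sigma_topology_def topology_generated_by_topspace by blast
qed

text \<open>Replaces topology by algebra. Forwards, each \<open>y\<close> composed with
  \<open>R\<close> is a \<sigma>-continuous functional and hence again given by an element of Y;
  backwards, preimages of generators are generators.\<close>

lemma sigma_operator_iff:
  "R \<in> sigma_operators pairing \<longleftrightarrow> (\<exists>R'. \<forall>x y. pairing (R x) y = pairing x (R' y))"
proof
  assume "R \<in> sigma_operators pairing"
  then have lin: "clinear R" and cont: "continuous_map (sigma_topology pairing) (sigma_topology pairing) R"
    by (simp_all add: sigma_operators_def)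
  note R = clinearD[OF lin]
  have "\<exists>y'. \<forall>x. pairing (R x) y = pairing x y'" for y
  proof -
    \<comment> \<open>The preimage of the unit ball contains a subspace of finite codimension; being linear and
      bounded there, the functional vanishes on it.\<close>
    let ?B = "(\<lambda>x. pairing x y) -` ball 0 1"
    have "openin (sigma_topology pairing) ?B"
      unfolding sigma_topology_def by (rule topology_generated_by_Basis) blast
    then have "openin (sigma_topology pairing) (R -` ?B)"
      using openin_continuous_map_preimage[OF cont, of ?B] by (simp add: topspace_sigma vimage_def)
    moreover have "0 \<in> R -` ?B" by (simp add: R left_simps)
    ultimately obtain F where F: "finite F" "{x. \<forall>y\<in>F. pairing x y = pairing 0 y} \<subseteq> R -` ?B"
      using sigma_open_contains_annihilator by blast
    have "pairing (R x) y = 0" if x: "\<And>z. z \<in> F \<Longrightarrow> pairing x z = 0" for x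
    proof (rule ccontr)
      let ?w = "pairing (R x) y"
      assume "?w \<noteq> 0"
      \<comment> \<open>Scaled so that its image under \<open>R\<close> pairs with \<open>y\<close>
        to exactly 1, just outside the open unit ball.\<close>
      have "(1 / ?w) *\<^sub>C x \<in> {x. \<forall>y\<in>F. pairing x y = pairing 0 y}"
        using x by (simp add: left_simps)
      then have "(1 / ?w) *\<^sub>C x \<in> R -` ?B"
        using F(2) by blast
      with \<open>?w \<noteq> 0\<close> show False by (simp add: R left_simps)
    qed
    moreover have "clinear (\<lambda>x. pairing (R x) y)"
      by (rule clinearI) (simp_all add: R left_simps)
    ultimately show ?thesis using F(1) functional_eq_pairing by blast
  qed
  then show "\<exists>R'. \<forall>x y. pairing (R x) y = pairing x (R' y)" by metis
next
  assume "\<exists>R'. \<forall>x y. pairing (R x) y = pairing x (R' y)"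
  then obtain R' where adj: "\<And>x y. pairing (R x) y = pairing x (R' y)" by blast
  have "clinear R"
    by (intro clinearI pairing_eqI) (simp_all add: adj left_simps)
  moreover have "continuous_map (sigma_topology pairing) (sigma_topology pairing) R"
    unfolding sigma_topology_def
  proof (rule continuous_on_generated_topo)
    show "openin (topology_generated_by {(\<lambda>x. pairing x y) -` U | y U. open U})
        (R -` V \<inter> topspace (topology_generated_by {(\<lambda>x. pairing x y) -` U | y U. open U}))"
      if "V \<in> {(\<lambda>x. pairing x y) -` U | y U. open U}" for V
    proof -
      from that obtain y U where V: "V = (\<lambda>x. pairing x y) -` U" "open U" by blast
      then have "R -` V = (\<lambda>x. pairing x (R' y)) -` U" by (auto simp: adj)
      then show ?thesis
        using topspace_sigma V(2)
        by (auto simp: sigma_topology_def simp del: topology_generated_by_topspace intro!: topology_generated_by_Basis)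
    qed
    show "R ` topspace (topology_generated_by {(\<lambda>x. pairing x y) -` U | y U. open U})
        \<subseteq> \<Union> {(\<lambda>x. pairing x y) -` U | y U. open U}"
      using topspace_sigma unfolding sigma_topology_def topology_generated_by_topspace by blast
  qed
  ultimately show "R \<in> sigma_operators pairing" by (simp add: sigma_operators_def)
qed

lemma sigma_adjoint_eq:
  assumes "R \<in> sigma_operators pairing"
  shows "pairing (R x) y = pairing x (sigma_adjoint pairing R y)"
proof -
  obtain R' where R': "\<forall>x y. pairing (R x) y = pairing x (R' y)"
    using assms sigma_operator_iff by blast
  have "sigma_adjoint pairing R = R'"
    unfolding sigma_adjoint_def
  proof (rule the_equality)
    fix S assume "\<forall>x y. pairing (R x) y = pairing x (S y)"
    then have "S y = R' y" for y
      using R' by (intro norming_dual_pair.pairing_eqI[OF flip_pair]) metis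
    then show "S = R'" by blast
  qed (fact R')
  then show ?thesis using R' by simp
qed

section \<open>Integrals of weighted orbits\<close>

text \<open>The weak integral of \<open>F\<close> with weight \<open>f\<close> belongs to the copy
  of X in the dual of Y. Bochner integrals default to 0, so this carries no integrability, which is
  tracked separately.\<close>

definition representable :: "'m measure \<Rightarrow> ('m \<Rightarrow> 'a) \<Rightarrow> ('m \<Rightarrow> complex) \<Rightarrow> bool"
  where "representable N F f \<longleftrightarrow> (\<exists>u. \<forall>y. pairing u y = (LINT t|N. f t * pairing (F t) y))"

lemma integrable_pairing:
  assumes meas: "(\<lambda>t. pairing (F t) y) \<in> borel_measurable N" "f \<in> borel_measurable N"
    and int: "integrable N (\<lambda>t. g t * w t)"
    and fg: "AE t in N. norm (f t) \<le> g t"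
    and F: "AE t in N. norm (F t) \<le> w t"
  shows "integrable N (\<lambda>t. f t * pairing (F t) y)"
proof (rule Bochner_Integration.integrable_bound)
  show "integrable N (\<lambda>t. g t * w t * norm y)" using int by simp
  show "(\<lambda>t. f t * pairing (F t) y) \<in> borel_measurable N" using meas by measurable
  show "AE t in N. norm (f t * pairing (F t) y) \<le> norm (g t * w t * norm y)"
    using fg F
  proof eventually_elim
    case (elim t)
    have "cmod (f t) * cmod (pairing (F t) y) \<le> g t * (w t * norm y)"
    proof (rule mult_mono)
      show "cmod (pairing (F t) y) \<le> w t * norm y"
        using cmod_pairing_le[of "F t" y] mult_right_mono[OF elim(2) norm_ge_zero[of y]] by linarith
      show "0 \<le> g t" using elim(1) norm_ge_zero order_trans by blast
    qed (use elim(1) in simp_all)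
    then show ?case by (simp add: norm_mult mult.assoc)
  qed
qed

text \<open>X is norm closed in the dual of Y by completeness, so it suffices that the functionals
  converge in norm. Dominated convergence supplies this because the error bound \<open>e n\<close>
  does not involve \<open>y\<close>.\<close>

lemma representable_limit:
  assumes meas: "\<And>y. (\<lambda>t. pairing (F t) y) \<in> borel_measurable N"
    and f: "\<And>n. f n \<in> borel_measurable N" "l \<in> borel_measurable N"
    and w: "w \<in> borel_measurable N"
    and int: "integrable N (\<lambda>t. g t * w t)"
    and F: "AE t in N. norm (F t) \<le> w t"
    and fg: "\<And>n. AE t in N. norm (f n t) \<le> g t"
    and lim: "AE t in N. (\<lambda>n. f n t) \<longlonglongrightarrow> l t"
    and rep: "\<And>n. representable N F (f n)"
  shows "representable N F l"
proof -
  have all: "AE t in N. \<forall>n. norm (f n t) \<le> g t" using fg by (simp add: AE_all_countable)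
  have lg: "AE t in N. norm (l t) \<le> g t"
    using all lim by eventually_elim (rule LIMSEQ_le_const2, rule tendsto_norm, auto)
  have intF: "integrable N (\<lambda>t. f n t * pairing (F t) y)" for n y
    by (rule integrable_pairing[OF meas f(1) int fg F])
  have intl: "integrable N (\<lambda>t. l t * pairing (F t) y)" for y
    by (rule integrable_pairing[OF meas f(2) int lg F])
  \<comment> \<open>The majorant \<open>w\<close> stands in for \<open>norm (F t)\<close>, whose
    measurability does not follow from that of the scalar functions.\<close>
  define e where "e n = (LINT t|N. norm (f n t - l t) * w t)" for n
  have dom: "AE t in N. norm (norm (f n t - l t) * w t) \<le> 2 * (g t * w t)" for n
    using fg[of n] lg F
  proof eventually_elim
    case (elim t)
    have "0 \<le> w t" using elim(3) norm_ge_zero order_trans by blast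
    moreover have "norm (f n t - l t) \<le> 2 * g t" using elim norm_triangle_ineq4[of "f n t" "l t"] by linarith
    ultimately show ?case using mult_right_mono[of "norm (f n t - l t)" "2 * g t" "w t"] by simp
  qed
  note [measurable] = f w
  have diff_meas: "(\<lambda>t. norm (f n t - l t) * w t) \<in> borel_measurable N" for n
    by measurable
  have inte: "integrable N (\<lambda>t. norm (f n t - l t) * w t)" for n
  proof (rule Bochner_Integration.integrable_bound)
    show "integrable N (\<lambda>t. 2 * (g t * w t))" using int by simp
    show "AE t in N. norm (norm (f n t - l t) * w t) \<le> norm (2 * (g t * w t))"
      using dom[of n] by eventually_elim simp
  qed (rule diff_meas)
  have e0: "e \<longlonglongrightarrow> 0"
  proof -
    have "(\<lambda>n. LINT t|N. norm (f n t - l t) * w t) \<longlonglongrightarrow> (LINT t|N. 0)"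
    proof (rule integral_dominated_convergence)
      show "integrable N (\<lambda>t. 2 * (g t * w t))" using int by simp
      show "AE t in N. (\<lambda>n. norm (f n t - l t) * w t) \<longlonglongrightarrow> 0"
        using lim by eventually_elim (intro tendsto_mult_left_zero tendsto_norm_zero, simp add: LIM_zero)
    qed (simp_all only: diff_meas dom borel_measurable_const)
    then show ?thesis by (simp add: e_def[abs_def])
  qed
  have e_nonneg: "0 \<le> e n" for n
    unfolding e_def using F
    by (intro integral_nonneg_AE) (auto elim!: eventually_mono intro!: mult_nonneg_nonneg intro: order_trans[OF norm_ge_zero])
  have est: "norm ((LINT t|N. f n t * pairing (F t) y) - (LINT t|N. l t * pairing (F t) y)) \<le> e n * norm y" for n y
  proof -
    have "(LINT t|N. f n t * pairing (F t) y) - (LINT t|N. l t * pairing (F t) y)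
        = (LINT t|N. (f n t - l t) * pairing (F t) y)"
      using intF intl by (simp add: left_diff_distrib)
    also have "norm \<dots> \<le> (LINT t|N. norm ((f n t - l t) * pairing (F t) y))"
      by (rule integral_norm_bound)
    also have "\<dots> \<le> (LINT t|N. norm (f n t - l t) * w t * norm y)"
    proof (rule integral_mono_AE)
      show "integrable N (\<lambda>t. norm ((f n t - l t) * pairing (F t) y))"
        using intF[of n y] intl[of y] by (intro integrable_norm) (simp add: left_diff_distrib)
      show "integrable N (\<lambda>t. norm (f n t - l t) * w t * norm y)" using inte[of n] by simp
      show "AE t in N. norm ((f n t - l t) * pairing (F t) y) \<le> norm (f n t - l t) * w t * norm y"
        using F
      proof eventually_elim
        case (elim t)
        have "cmod (pairing (F t) y) \<le> w t * norm y"
          using cmod_pairing_le[of "F t" y] mult_right_mono[OF elim norm_ge_zero[of y]] by linarith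
        then show ?case by (simp add: norm_mult mult.assoc mult_left_mono)
      qed
    qed
    also have "\<dots> = e n * norm y" by (simp add: e_def)
    finally show ?thesis .
  qed
  obtain u where u: "\<And>n y. pairing (u n) y = (LINT t|N. f n t * pairing (F t) y)"
    using rep unfolding representable_def by metis
  let ?I = "\<lambda>y. LINT t|N. l t * pairing (F t) y"
  \<comment> \<open>Both functionals are compared with the limit functional \<open>?I\<close>, which
    is not yet known to come from X.\<close>
  have "norm (u m - u n) \<le> e m + e n" for m n
  proof (rule norm_le_pairingI)
    show "cmod (pairing (u m - u n) y) \<le> (e m + e n) * norm y" for y
      using norm_triangle_le_diff[of "pairing (u m) y - ?I y" "pairing (u n) y - ?I y" "(e m + e n) * norm y"]
        est[of m y] est[of n y] unfolding left_simps u by (simp add: distrib_right)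
  qed (simp add: e_nonneg)
  have "Cauchy u"
  proof (rule metric_CauchyI)
    fix r :: real assume "0 < r"
    then obtain n0 where "\<And>n. n \<ge> n0 \<Longrightarrow> e n < r / 2"
      using LIMSEQ_D[OF e0, of "r / 2"] by (auto simp: e_nonneg)
    then have "dist (u m) (u n) < r" if "m \<ge> n0" "n \<ge> n0" for m n
      using \<open>norm (u m - u n) \<le> e m + e n\<close> that by (smt (verit) dist_norm field_sum_of_halves)
    then show "\<exists>n0. \<forall>m\<ge>n0. \<forall>n\<ge>n0. dist (u m) (u n) < r" by blast
  qed
  then obtain v where v: "u \<longlonglongrightarrow> v" by (auto simp: Cauchy_convergent_iff convergent_def)
  have "pairing v y = (LINT t|N. l t * pairing (F t) y)" for y
  proof (rule LIMSEQ_unique[OF tendsto_pairing[OF v]])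
    have "(\<lambda>n. e n * norm y) \<longlonglongrightarrow> 0" using e0 by (rule tendsto_mult_left_zero)
    then have "(\<lambda>n. pairing (u n) y - (LINT t|N. l t * pairing (F t) y)) \<longlonglongrightarrow> 0"
      unfolding u by (rule Lim_null_comparison[rotated]) (simp add: est)
    then show "(\<lambda>n. pairing (u n) y) \<longlonglongrightarrow> (LINT t|N. l t * pairing (F t) y)"
      by (rule LIM_zero_cancel)
  qed
  then show ?thesis unfolding representable_def by blast
qed
lemma representable_add:
  assumes "representable N F f" "representable N F g"
    and "\<And>y. integrable N (\<lambda>t. f t * pairing (F t) y)" "\<And>y. integrable N (\<lambda>t. g t * pairing (F t) y)"
  shows "representable N F (\<lambda>t. f t + g t)"
proof -
  obtain u v where "\<And>y. pairing u y = (LINT t|N. f t * pairing (F t) y)"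
    "\<And>y. pairing v y = (LINT t|N. g t * pairing (F t) y)"
    using assms unfolding representable_def by metis
  then have "pairing (u + v) y = (LINT t|N. (f t + g t) * pairing (F t) y)" for y
    using assms(3,4)[of y] by (simp add: left_simps distrib_right)
  then show ?thesis unfolding representable_def by blast
qed

lemma representable_cmult:
  assumes "representable N F f"
  shows "representable N F (\<lambda>t. c * f t)"
proof -
  obtain u where "\<And>y. pairing u y = (LINT t|N. f t * pairing (F t) y)"
    using assms unfolding representable_def by metis
  then have "pairing (c *\<^sub>C u) y = (LINT t|N. (c * f t) * pairing (F t) y)" for y
    by (simp add: left_simps mult.assoc)
  then show ?thesis unfolding representable_def by blast
qed

lemma representable_sum:
  assumes "finite I" "\<And>i. i \<in> I \<Longrightarrow> representable N F (f i)"
    and "\<And>i y. i \<in> I \<Longrightarrow> integrable N (\<lambda>t. f i t * pairing (F t) y)"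
  shows "representable N F (\<lambda>t. \<Sum>i\<in>I. c i * f i t)"
  using assms
proof (induction I rule: finite_induct)
  case empty
  have "pairing 0 y = (LINT t|N. 0 * pairing (F t) y)" for y by (simp add: left_simps)
  then show ?case unfolding representable_def by auto
next
  case (insert j I)
  have "representable N F (\<lambda>t. c j * f j t + (\<Sum>i\<in>I. c i * f i t))"
  proof (rule representable_add)
    show "representable N F (\<lambda>t. c j * f j t)" using insert.prems by (intro representable_cmult) simp
    show "representable N F (\<lambda>t. \<Sum>i\<in>I. c i * f i t)" using insert.prems by (intro insert.IH) simp_all
    show "integrable N (\<lambda>t. (c j * f j t) * pairing (F t) y)" for y
      using insert.prems(2)[of j y] by (simp add: mult.assoc)
    show "integrable N (\<lambda>t. (\<Sum>i\<in>I. c i * f i t) * pairing (F t) y)" for y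
      unfolding sum_distrib_right mult.assoc
      by (intro Bochner_Integration.integrable_sum integrable_mult_right insert.prems) simp
  qed
  then show ?case using insert.hyps by simp
qed

text \<open>Integrals over measurable sets are the case of indicator weights. Simple functions and
  then dominated limits reach every integrable weight, the bound on \<open>F\<close> keeping all
  products integrable.\<close>

lemma pair_integrable_imp_representable:
  assumes pint: "pair_integrable pairing N F"
    and bound: "AE t in N. norm (F t) \<le> K"
    and f: "integrable N f"
  shows "representable N F f"
proof -
  have meas: "(\<lambda>t. pairing (F t) y) \<in> borel_measurable N" for y
    using pint by (intro borel_measurable_integrable) (simp add: pair_integrable_def scalarly_integrable_def)
  have int: "integrable N (\<lambda>t. g t * pairing (F t) y)" if "integrable N g" for g y
    using that by (intro integrable_pairing[OF meas _ _ _ bound, where g = "\<lambda>t. norm (g t)"]) auto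
  from f show ?thesis
  proof (induction rule: integrable_induct)
    case (base A c)
    have "weak_integral pairing N A F \<in> range pairing"
      using pint base(1) by (simp add: pair_integrable_def)
    then obtain u where "pairing u = weak_integral pairing N A F" by force
    then have u: "pairing u y = (LINT t|N. indicator A t *\<^sub>R pairing (F t) y)" for y
      by (simp add: weak_integral_def set_lebesgue_integral_def)
    have "pairing (c *\<^sub>C u) y = (LINT t|N. indicator A t *\<^sub>R c * pairing (F t) y)" for y
    proof -
      have "pairing (c *\<^sub>C u) y = (LINT t|N. c * (indicator A t *\<^sub>R pairing (F t) y))"
        unfolding left_simps scaleC_complex u by (rule integral_mult_right_zero[symmetric])
      also have "\<dots> = (LINT t|N. indicator A t *\<^sub>R c * pairing (F t) y)" by (simp add: mult.commute)
      finally show ?thesis .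
    qed
    then show ?case unfolding representable_def by blast
  next
    case (add f g)
    then show ?case by (intro representable_add int)
  next
    case (lim f s)
    show ?case
    \<comment> \<open>The approximants \<open>s\<close> have norm at most twice that of
      \<open>f\<close>, which gives the dominating function.\<close>
    proof (rule representable_limit[OF meas, where f = s and w = "\<lambda>_. K" and g = "\<lambda>t. 2 * norm (f t)"])
      show "integrable N (\<lambda>t. 2 * norm (f t) * K)" using lim by simp
    qed (use lim bound in auto)
  qed
qed

end

section \<open>Lebesgue measure on the half line\<close>

abbreviation half_line :: "real measure"
  where "half_line \<equiv> lebesgue_on {0..}"

text \<open>Turns integrals over subsets into weighted integrals for one fixed measure, so that
  truncation becomes a choice of weight.\<close>

lemma integral_half_line_restrict:
  fixes h :: "real \<Rightarrow> 'c::euclidean_space"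
  assumes "J \<in> sets lebesgue" "J \<subseteq> {0..}"
  shows "integral\<^sup>L (lebesgue_on J) h = (LINT t|half_line. indicator J t *\<^sub>R h t)"
    and "integrable (lebesgue_on J) h \<longleftrightarrow> integrable half_line (\<lambda>t. indicator J t *\<^sub>R h t)"
proof -
  have "(\<lambda>t. indicat_real {0..} t *\<^sub>R indicat_real J t *\<^sub>R h t) = (\<lambda>t. indicator J t *\<^sub>R h t)"
    using assms(2) by (intro ext) (auto simp: indicator_def)
  then show "integral\<^sup>L (lebesgue_on J) h = (LINT t|half_line. indicator J t *\<^sub>R h t)"
    "integrable (lebesgue_on J) h \<longleftrightarrow> integrable half_line (\<lambda>t. indicator J t *\<^sub>R h t)"
    using assms(1) by (simp_all add: integral_restrict_space integrable_restrict_space)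
qed

lemma integral_half_line_shift:
  fixes k :: "real \<Rightarrow> 'c::euclidean_space"
  assumes "0 \<le> t"
  shows "(LINT s|half_line. k (t + s)) = (LINT r|half_line. indicator {t..} r *\<^sub>R k r)"
proof -
  have "(LINT r|half_line. indicator {t..} r *\<^sub>R k r)
      = (LINT r|lebesgue. indicator {0..} r *\<^sub>R indicator {t..} r *\<^sub>R k r)"
    by (simp add: integral_restrict_space)
  also have "\<dots> = (LINT s|lebesgue. indicator {0..} (t + s) *\<^sub>R indicator {t..} (t + s) *\<^sub>R k (t + s))"
    using lebesgue_integral_real_affine[of 1 "\<lambda>r. indicator {0..} r *\<^sub>R indicator {t..} r *\<^sub>R k r" t] by simp
  \<comment> \<open>Since \<open>t\<close> is nonnegative, the conditions
    \<open>t + s \<ge> 0\<close> and \<open>t + s \<ge> t\<close> together reduce to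
    \<open>s \<ge> 0\<close>.\<close>
  also have "\<dots> = (LINT s|lebesgue. indicator {0..} s *\<^sub>R k (t + s))"
    using assms by (intro Bochner_Integration.integral_cong) (auto simp: indicator_def)
  finally show ?thesis by (simp add: integral_restrict_space)
qed

lemma exp_half_line:
  fixes a :: real
  assumes "a > 0"
  shows "integrable half_line (\<lambda>t. exp (- a * t))" "(LINT t|half_line. exp (- a * t)) = 1 / a"
proof -
  have I: "((\<lambda>t. exp (- a * t)) has_integral 1 / a) {0..}"
    using has_integral_exp_minus_to_infinity[OF assms, of 0] by simp
  then have "(\<lambda>t. exp (- a * t)) absolutely_integrable_on {0..}"
    by (intro nonnegative_absolutely_integrable_1) (auto simp: integrable_on_def)
  then show int: "integrable half_line (\<lambda>t. exp (- a * t))"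
    by (simp add: set_integrable_def integrable_restrict_space)
  show "(LINT t|half_line. exp (- a * t)) = 1 / a"
    using lebesgue_integral_eq_integral[OF int] I by (simp add: integral_unique)
qed

lemma integral_exp_initial_segment:
  fixes d r :: real
  assumes "d \<noteq> 0" "0 \<le> r"
  shows "(LINT t|half_line. indicator {..r} t *\<^sub>R exp (- d * t)) = (1 - exp (- d * r)) / d"
proof -
  have "(LINT t|half_line. indicator {..r} t *\<^sub>R exp (- d * t))
      = (LINT t|half_line. indicator {0..r} t *\<^sub>R exp (- d * t))"
    by (intro Bochner_Integration.integral_cong) (auto simp: indicator_def)
  also have "\<dots> = integral\<^sup>L (lebesgue_on {0..r}) (\<lambda>t. exp (- d * t))"
    by (rule integral_half_line_restrict(1)[symmetric]) auto
  also have "\<dots> = integral {0..r} (\<lambda>t. exp (- d * t))"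
  proof (rule lebesgue_integral_eq_integral)
    show "integrable (lebesgue_on {0..r}) (\<lambda>t. exp (- d * t))"
      by (intro integrable_continuous_real[THEN nonnegative_absolutely_integrable_1, unfolded set_integrable_def, simplified]
          continuous_imp_integrable_real continuous_intros)
  qed simp
  also have "((\<lambda>t. exp (- d * t)) has_integral (- exp (- d * r) / d - (- exp (- d * 0) / d))) {0..r}"
    using assms by (intro fundamental_theorem_of_calculus)
      (auto intro!: derivative_eq_intros simp flip: has_real_derivative_iff_has_vector_derivative)
  then have "integral {0..r} (\<lambda>t. exp (- d * t)) = (1 - exp (- d * r)) / d"
    by (simp add: integral_unique diff_divide_distrib)
  finally show ?thesis .
qed

lemma sigma_finite_half_line: "sigma_finite_measure half_line"
proof (rule sigma_finite_measure_restrict_space)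
  show "sigma_finite_measure (lebesgue :: real measure)"
    unfolding sigma_finite_measure_def
  proof (intro exI[of _ "range (\<lambda>n::nat. {- real n..real n})"] conjI)
    show "\<Union> (range (\<lambda>n::nat. {- real n..real n})) = space lebesgue"
    proof (intro equalityI subsetI)
      fix x :: real
      obtain n :: nat where "\<bar>x\<bar> \<le> real n" using real_arch_simple by blast
      then have "x \<in> {- real n..real n}" by auto
      then show "x \<in> \<Union> (range (\<lambda>n::nat. {- real n..real n}))" by blast
    qed simp
  qed auto
qed simp

section \<open>Semigroups with measurable orbits and their Laplace transforms\<close>

text \<open>The adjoint family is a parameter so that the assumptions survive the exchange of X and
  Y; every result below then also holds for the adjoint semigroup.\<close>

locale dual_semigroup = norming_dual_pair pairing
  for pairing :: "'a::complex_banach \<Rightarrow> 'b::complex_banach \<Rightarrow> complex" +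
  fixes S :: "real \<Rightarrow> 'a \<Rightarrow> 'a" and S' :: "real \<Rightarrow> 'b \<Rightarrow> 'b" and M \<omega> :: real
  assumes adjoint: "0 \<le> t \<Longrightarrow> pairing (S t x) y = pairing x (S' t y)"
    and semigroup: "0 \<le> t \<Longrightarrow> 0 \<le> s \<Longrightarrow> S (t + s) x = S t (S s x)"
    and bound: "0 \<le> t \<Longrightarrow> norm (S t x) \<le> M * exp (\<omega> * t) * norm x"
    and M_ge_1: "1 \<le> M"
    and measurable_orbit: "(\<lambda>t. pairing (S t x) y) \<in> borel_measurable half_line"
begin

lemma flip_dual_semigroup: "dual_semigroup (flip pairing) S' S M \<omega>"
proof -
  interpret flip: norming_dual_pair "flip pairing" by (rule flip_pair)
  show ?thesis
  proof unfold_locales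
    show "pairing x (S' t y) = pairing (S t x) y" if "0 \<le> t" for t x y
      using adjoint[OF that] by simp
    \<comment> \<open>Adjoints reverse composition; commuting the two times restores the
      order.\<close>
    show "S' (t + s) y = S' t (S' s y)" if "0 \<le> t" "0 \<le> s" for t s y
      by (rule flip.pairing_eqI) (simp add: that semigroup adjoint[symmetric] add.commute[of t s])
    show "norm (S' t y) \<le> M * exp (\<omega> * t) * norm y" if "0 \<le> t" for t y
    proof (rule flip.norm_le_pairingI)
      show "0 \<le> M * exp (\<omega> * t) * norm y" using M_ge_1 by simp
      show "cmod (pairing x (S' t y)) \<le> M * exp (\<omega> * t) * norm y * norm x" for x
        using cmod_pairing_le[of "S t x" y] mult_right_mono[OF bound[OF that, of x] norm_ge_zero[of y]]
        by (simp add: adjoint[OF that, symmetric] mult_ac)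
    qed
    show "(\<lambda>t. pairing x (S' t y)) \<in> borel_measurable half_line" for x y
      using measurable_orbit[of x y] by (rule measurable_cong[THEN iffD1, rotated]) (simp add: adjoint)
  qed (rule M_ge_1)
qed

text \<open>Possession of an adjoint forces linearity, as Y separates the points of X.\<close>

lemma S_simps:
  assumes "0 \<le> t"
  shows "S t (x + x') = S t x + S t x'" "S t (c *\<^sub>C x) = c *\<^sub>C S t x" "S t (x - x') = S t x - S t x'"
  by (rule pairing_eqI, simp add: adjoint assms left_simps)+

lemma AE_bound: "AE t in half_line. norm (S t x) \<le> M * exp (\<omega> * t) * norm x"
  by (rule AE_I2) (simp add: bound)

lemma measurable_continuous_half_line [measurable]:
  "continuous_on UNIV f \<Longrightarrow> f \<in> borel_measurable half_line"
  by (intro measurable_restrict_space1 measurable_completion) (simp add: borel_measurable_continuous_onI)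

lemma integrable_weight:
  assumes "\<omega> < b"
  shows "integrable half_line (\<lambda>t. C * exp (- b * t) * (M * exp (\<omega> * t) * norm x))"
proof -
  have "integrable half_line (\<lambda>t. (C * M * norm x) * exp (- (b - \<omega>) * t))"
    using exp_half_line(1)[of "b - \<omega>"] assms by (intro integrable_mult_right) simp
  then show ?thesis by (simp add: algebra_simps exp_add exp_diff exp_minus field_simps)
qed

lemma integrable_orbit:
  assumes "f \<in> borel_measurable half_line" "\<omega> < b" "\<And>t. 0 \<le> t \<Longrightarrow> cmod (f t) \<le> C * exp (- b * t)"
  shows "integrable half_line (\<lambda>t. f t * pairing (S t x) y)"
proof (rule integrable_pairing[OF measurable_orbit assms(1) integrable_weight[OF assms(2), of C x] _ AE_bound])
  show "AE t in half_line. cmod (f t) \<le> C * exp (- b * t)"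
    by (rule AE_I2, rule assms(3)) simp
qed

lemma representable_orbit_limit:
  assumes "\<And>n. f n \<in> borel_measurable half_line" "l \<in> borel_measurable half_line" "\<omega> < b"
    and "\<And>n t. 0 \<le> t \<Longrightarrow> cmod (f n t) \<le> C * exp (- b * t)"
    and "AE t in half_line. (\<lambda>n. f n t) \<longlonglongrightarrow> l t"
    and "\<And>n. representable half_line (\<lambda>t. S t x) (f n)"
  shows "representable half_line (\<lambda>t. S t x) l"
proof (rule representable_limit[OF measurable_orbit assms(1,2) _ integrable_weight[OF assms(3), of C x] AE_bound _ assms(5,6)])
  show "AE t in half_line. cmod (f n t) \<le> C * exp (- b * t)" for n
    by (rule AE_I2, rule assms(4)) simp
qed (intro measurable_continuous_half_line continuous_intros)

text \<open>Concerns only the values of the Laplace transform at \<open>\<mu>\<close>, which are to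
  lie in X; its \<sigma>-continuity is treated separately, through adjoints.\<close>

definition laplace :: "complex \<Rightarrow> bool"
  where "laplace \<mu> \<longleftrightarrow> (\<forall>x. representable half_line (\<lambda>t. S t x) (\<lambda>t. exp (- \<mu> * complex_of_real t)))"

lemma integrable_laplace:
  assumes "\<omega> < Re \<mu>"
  shows "integrable half_line (\<lambda>t. exp (- \<mu> * complex_of_real t) * pairing (S t x) y)"
  using assms by (intro integrable_orbit[where b = "Re \<mu>" and C = 1] measurable_continuous_half_line continuous_intros)
    simp_all

section \<open>From local integrability to Laplace transforms\<close>

text \<open>The exponential is truncated to \<open>{0..real n}\<close>, where local integrability
  applies, and recovered as a dominated limit.\<close>

lemma representable_exp_of_locally_integrable:
  assumes loc: "locally_pair_integrable pairing (\<lambda>t. S t x)" and \<mu>: "\<omega> < Re \<mu>"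
  shows "representable half_line (\<lambda>t. S t x) (\<lambda>t. exp (- \<mu> * complex_of_real t))"
proof -
  let ?e = "\<lambda>t. exp (- \<mu> * complex_of_real t)"
  let ?f = "\<lambda>n t. indicat_real {0..real n} t *\<^sub>R ?e t"
  have e: "?e \<in> borel_measurable half_line"
    by (intro measurable_continuous_half_line continuous_intros)
  have f: "?f n \<in> borel_measurable half_line" for n
    using e by measurable
  show ?thesis
  proof (rule representable_orbit_limit[OF f e \<mu>, where C = 1])
    show "cmod (?f n t) \<le> 1 * exp (- Re \<mu> * t)" for n t by (simp add: indicator_def)
    show "AE t in half_line. (\<lambda>n. ?f n t) \<longlonglongrightarrow> ?e t"
    proof (rule AE_I2)
      fix t :: real assume "t \<in> space half_line"
      moreover obtain m :: nat where "t \<le> real m" using real_arch_simple by blast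
      ultimately have "\<forall>\<^sub>F n in sequentially. ?f n t = ?e t"
        by (intro eventually_sequentiallyI[of m]) auto
      then show "(\<lambda>n. ?f n t) \<longlonglongrightarrow> ?e t" by (rule tendsto_eventually)
    qed
    show "representable half_line (\<lambda>t. S t x) (?f n)" for n
    proof -
      have "pair_integrable pairing (lebesgue_on {0..real n}) (\<lambda>t. S t x)"
        using loc by (simp add: locally_pair_integrable_def is_interval_cc)
      moreover have "AE t in lebesgue_on {0..real n}. norm (S t x) \<le> M * exp (\<bar>\<omega>\<bar> * n) * norm x"
      proof (rule AE_I2)
        fix t assume "t \<in> space (lebesgue_on {0..real n})"
        then have t: "0 \<le> t" "t \<le> n" by auto
        \<comment> \<open>The absolute value gives a bound uniform in \<open>t\<close> for either
          sign of \<open>\<omega>\<close>.\<close>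
        have "\<omega> * t \<le> \<bar>\<omega>\<bar> * n" using t by (intro mult_mono) auto
        then have "M * exp (\<omega> * t) * norm x \<le> M * exp (\<bar>\<omega>\<bar> * n) * norm x"
          using M_ge_1 by (intro mult_right_mono mult_left_mono) auto
        with bound[OF t(1), of x] show "norm (S t x) \<le> M * exp (\<bar>\<omega>\<bar> * n) * norm x" by linarith
      qed
      moreover have "integrable (lebesgue_on {0..real n}) ?e"
        by (intro continuous_imp_integrable_real continuous_intros)
      ultimately have "representable (lebesgue_on {0..real n}) (\<lambda>t. S t x) ?e"
        by (rule pair_integrable_imp_representable)
      then show ?thesis
        by (simp add: representable_def integral_half_line_restrict(1)[of "{0..real n}"])
    qed
  qed
qed

section \<open>Resolvent identity and shifts of the Laplace parameter\<close>

text \<open>Applying \<open>S t\<close> to a Laplace transform moves the integrand forward by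
  \<open>t\<close>, leaving the tail of the integral that defines \<open>u\<close>.
  \<open>S t\<close> passes under the weak integral by being moved to \<open>y\<close> as
  \<open>S' t\<close>.\<close>

lemma laplace_orbit_shift:
  assumes "0 \<le> t" "\<And>y. pairing u y = (LINT s|half_line. exp (- \<mu> * complex_of_real s) * pairing (S s x) y)"
  shows "exp (- \<mu> * complex_of_real t) * pairing (S t u) y
    = (LINT r|half_line. indicator {t..} r *\<^sub>R (exp (- \<mu> * complex_of_real r) * pairing (S r x) y))"
proof -
  have "exp (- \<mu> * complex_of_real t) * pairing (S t u) y
      = (LINT s|half_line. exp (- \<mu> * complex_of_real t) * (exp (- \<mu> * complex_of_real s) * pairing (S s x) (S' t y)))"
    by (simp add: adjoint assms)
  also have "\<dots> = (LINT s|half_line. exp (- \<mu> * complex_of_real (t + s)) * pairing (S (t + s) x) y)"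
  proof (rule Bochner_Integration.integral_cong[OF refl])
    fix s assume "s \<in> space half_line"
    then have "pairing (S s x) (S' t y) = pairing (S (t + s) x) y"
      using assms(1) by (simp add: semigroup adjoint[OF assms(1), symmetric])
    then show "exp (- \<mu> * complex_of_real t) * (exp (- \<mu> * complex_of_real s) * pairing (S s x) (S' t y))
        = exp (- \<mu> * complex_of_real (t + s)) * pairing (S (t + s) x) y"
      by (simp add: exp_add[symmetric] mult.assoc[symmetric] algebra_simps)
  qed
  also have "\<dots> = (LINT r|half_line. indicator {t..} r *\<^sub>R (exp (- \<mu> * complex_of_real r) * pairing (S r x) y))"
    using assms(1) by (rule integral_half_line_shift)
  finally show ?thesis .
qed

text \<open>Insert the tail formula for the orbit of \<open>u\<close> and exchange the integrals;
  integrating \<open>exp (- d * t)\<close> over \<open>{0..r}\<close> produces the difference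
  quotient. The form with a fixed \<open>y\<close> is used because the transform at
  \<open>\<mu> + d\<close> is not yet known to take values in X.\<close>

lemma resolvent_identity:
  assumes \<mu>: "\<omega> < Re \<mu>" and d: "0 < d"
    and u: "\<And>y. pairing u y = (LINT s|half_line. exp (- \<mu> * complex_of_real s) * pairing (S s x) y)"
  shows "(LINT t|half_line. exp (- (\<mu> + complex_of_real d) * complex_of_real t) * pairing (S t u) y)
    = (pairing u y - (LINT t|half_line. exp (- (\<mu> + complex_of_real d) * complex_of_real t) * pairing (S t x) y)) / d"
proof -
  define h where "h r = exp (- \<mu> * complex_of_real r) * pairing (S r x) y" for r
  \<comment> \<open>Integrand on the triangle \<open>t \<le> r\<close>, whose two iterated integrals
    are the two sides of the identity.\<close>
  define \<Phi> where "\<Phi> t r = (if t \<le> r then complex_of_real (exp (- d * t)) * h r else 0)" for t r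
  interpret N: sigma_finite_measure half_line by (rule sigma_finite_half_line)
  interpret P: pair_sigma_finite half_line half_line by unfold_locales
  have h: "integrable half_line h"
    unfolding h_def using \<mu> by (rule integrable_laplace)
  have [measurable]: "h \<in> borel_measurable half_line" using h by simp
  have [measurable]: "(\<lambda>t. t) \<in> borel_measurable half_line" "(\<lambda>t. exp (- d * t)) \<in> borel_measurable half_line"
    by (intro measurable_continuous_half_line continuous_intros)+
  have \<Phi>_int: "integrable half_line (\<Phi> t)" for t
  proof (rule Bochner_Integration.integrable_bound)
    show "integrable half_line (\<lambda>r. complex_of_real (exp (- d * t)) * h r)" using h by simp
    show "\<Phi> t \<in> borel_measurable half_line" unfolding \<Phi>_def by measurable
  qed (auto simp: \<Phi>_def)
  have \<Phi>_meas: "case_prod \<Phi> \<in> borel_measurable (half_line \<Otimes>\<^sub>M half_line)"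
    unfolding \<Phi>_def by measurable
  have "integrable (half_line \<Otimes>\<^sub>M half_line) (case_prod \<Phi>)"
  proof (rule P.Fubini_integrable[OF \<Phi>_meas])
    show "integrable half_line (\<lambda>t. LINT r|half_line. norm (case_prod \<Phi> (t, r)))"
    proof (rule Bochner_Integration.integrable_bound)
      show "integrable half_line (\<lambda>t. exp (- d * t) * (LINT r|half_line. norm (h r)))"
        using exp_half_line(1)[OF d] by simp
      show "(\<lambda>t. LINT r|half_line. norm (case_prod \<Phi> (t, r))) \<in> borel_measurable half_line"
        using \<Phi>_meas by measurable
      \<comment> \<open>Dropping the constraint \<open>t \<le> r\<close> leaves a decaying
        exponential times the integral of \<open>norm (h r)\<close>.\<close>
      have "(LINT r|half_line. norm (\<Phi> t r)) \<le> (LINT r|half_line. exp (- d * t) * norm (h r))" for t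
        using integrable_norm[OF h] integrable_norm[OF \<Phi>_int[of t]]
        by (intro integral_mono integrable_mult_right) (simp_all add: \<Phi>_def norm_mult)
      then show "AE t in half_line. norm (LINT r|half_line. norm (case_prod \<Phi> (t, r)))
          \<le> norm (exp (- d * t) * (LINT r|half_line. norm (h r)))"
        by (intro AE_I2) (simp add: abs_mult)
    qed
  qed (auto simp: \<Phi>_int)
  note Fubini = P.Fubini_integral[OF this]
  have exp_split: "exp (- (\<mu> + complex_of_real d) * complex_of_real t)
      = complex_of_real (exp (- d * t)) * exp (- \<mu> * complex_of_real t)" for t
    by (simp add: exp_of_real[symmetric] exp_add[symmetric] algebra_simps)
  have outer: "exp (- (\<mu> + complex_of_real d) * complex_of_real t) * pairing (S t u) y = (LINT r|half_line. \<Phi> t r)"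
    if "0 \<le> t" for t
  proof -
    have "exp (- (\<mu> + complex_of_real d) * complex_of_real t) * pairing (S t u) y
        = complex_of_real (exp (- d * t)) * (exp (- \<mu> * complex_of_real t) * pairing (S t u) y)"
      unfolding exp_split by (rule mult.assoc)
    also have "\<dots> = (LINT r|half_line. complex_of_real (exp (- d * t)) * (indicator {t..} r *\<^sub>R h r))"
      unfolding laplace_orbit_shift[OF that u] h_def by (rule integral_mult_right_zero[symmetric])
    also have "\<dots> = (LINT r|half_line. \<Phi> t r)"
      by (intro Bochner_Integration.integral_cong) (auto simp: \<Phi>_def)
    finally show ?thesis .
  qed
  have inner: "(LINT t|half_line. \<Phi> t r)
      = (h r - exp (- (\<mu> + complex_of_real d) * complex_of_real r) * pairing (S r x) y) / d" if "0 \<le> r" for r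
  proof -
    have "(LINT t|half_line. \<Phi> t r) = (LINT t|half_line. complex_of_real (indicator {..r} t *\<^sub>R exp (- d * t)) * h r)"
      by (intro Bochner_Integration.integral_cong) (auto simp: \<Phi>_def)
    also have "\<dots> = complex_of_real ((1 - exp (- d * r)) / d) * h r"
      using integral_exp_initial_segment[of d r] d that
      by (simp only: integral_mult_left_zero integral_complex_of_real)
    also have "\<dots> = (h r - exp (- (\<mu> + complex_of_real d) * complex_of_real r) * pairing (S r x) y) / d"
      unfolding exp_split h_def by (simp add: diff_divide_distrib left_diff_distrib)
    finally show ?thesis .
  qed
  have "(LINT t|half_line. exp (- (\<mu> + complex_of_real d) * complex_of_real t) * pairing (S t u) y)
      = (LINT t|half_line. LINT r|half_line. \<Phi> t r)"
    by (intro Bochner_Integration.integral_cong outer) auto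
  also have "\<dots> = (LINT r|half_line. LINT t|half_line. \<Phi> t r)"
    by (rule Fubini[symmetric])
  also have "\<dots> = (LINT r|half_line. (h r - exp (- (\<mu> + complex_of_real d) * complex_of_real r) * pairing (S r x) y) / d)"
    by (intro Bochner_Integration.integral_cong inner) auto
  also have "\<dots> = ((LINT r|half_line. h r)
      - (LINT r|half_line. exp (- (\<mu> + complex_of_real d) * complex_of_real r) * pairing (S r x) y)) / d"
    unfolding integral_divide_zero using h \<mu> d
    by (intro arg_cong[where f = "\<lambda>z. z / _"] Bochner_Integration.integral_diff integrable_laplace) simp_all
  finally show ?thesis by (simp add: u h_def)
qed

text \<open>With \<open>R\<close> the transform at \<open>\<mu>\<close>, write
  \<open>x = z + d R z\<close>; by the resolvent identity the transform of \<open>x\<close> at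
  \<open>\<mu> + d\<close> is then \<open>R z\<close>, an element of X. Such a \<open>z\<close>
  exists because the norm of \<open>R\<close> is at most \<open>M / (Re \<mu> - \<omega>)\<close>,
  which makes \<open>d R\<close> a strict contraction.\<close>

lemma laplace_step:
  assumes \<mu>: "\<omega> < Re \<mu>" and d: "0 < d" "d * M < Re \<mu> - \<omega>" and lap: "laplace \<mu>"
  shows "laplace (\<mu> + complex_of_real d)"
  unfolding laplace_def
proof
  fix x
  let ?e = "\<lambda>t. exp (- \<mu> * complex_of_real t)"
  let ?e' = "\<lambda>t. exp (- (\<mu> + complex_of_real d) * complex_of_real t)"
  let ?q = "M / (Re \<mu> - \<omega>)"
  obtain R where R: "\<And>x y. pairing (R x) y = (LINT t|half_line. ?e t * pairing (S t x) y)"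
    using lap unfolding laplace_def representable_def by metis
  \<comment> \<open>\<open>R\<close> was chosen pointwise; its additivity is read off the
    integrals.\<close>
  have R_diff: "R x - R x' = R (x - x')" for x x'
  proof (rule pairing_eqI)
    fix y
    have "pairing (R x - R x') y = (LINT t|half_line. ?e t * pairing (S t x) y - ?e t * pairing (S t x') y)"
      unfolding left_simps R by (intro Bochner_Integration.integral_diff[symmetric] integrable_laplace \<mu>)
    also have "\<dots> = pairing (R (x - x')) y"
      unfolding R by (intro Bochner_Integration.integral_cong) (simp_all add: S_simps left_simps algebra_simps)
    finally show "pairing (R x - R x') y = pairing (R (x - x')) y" .
  qed
  have R_bound: "norm (R x) \<le> ?q * norm x" for x
  proof (rule norm_le_pairingI)
    show "0 \<le> ?q * norm x" using M_ge_1 \<mu> by simp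
    fix y
    have "cmod (pairing (R x) y) \<le> (LINT t|half_line. cmod (?e t * pairing (S t x) y))"
      unfolding R by (rule integral_norm_bound)
    also have "\<dots> \<le> (LINT t|half_line. (M * norm x * norm y) * exp (- (Re \<mu> - \<omega>) * t))"
    proof (rule integral_mono)
      show "integrable half_line (\<lambda>t. cmod (?e t * pairing (S t x) y))"
        using \<mu> by (intro integrable_norm integrable_laplace)
      show "integrable half_line (\<lambda>t. (M * norm x * norm y) * exp (- (Re \<mu> - \<omega>) * t))"
        using exp_half_line(1)[of "Re \<mu> - \<omega>"] \<mu> by (intro integrable_mult_right) simp
      fix t assume "t \<in> space half_line"
      then have t: "0 \<le> t" by simp
      have "cmod (pairing (S t x) y) \<le> M * exp (\<omega> * t) * norm x * norm y"
        using cmod_pairing_le[of "S t x" y] mult_right_mono[OF bound[OF t, of x] norm_ge_zero[of y]] by linarith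
      then have "cmod (?e t * pairing (S t x) y) \<le> exp (- Re \<mu> * t) * (M * exp (\<omega> * t) * norm x * norm y)"
        by (simp add: norm_mult)
      also have "\<dots> = (M * norm x * norm y) * exp (- (Re \<mu> - \<omega>) * t)"
        by (simp add: algebra_simps exp_add[symmetric])
      finally show "cmod (?e t * pairing (S t x) y) \<le> (M * norm x * norm y) * exp (- (Re \<mu> - \<omega>) * t)" .
    qed
    also have "\<dots> = (M * norm x * norm y) * (1 / (Re \<mu> - \<omega>))"
      using exp_half_line(2)[of "Re \<mu> - \<omega>"] \<mu> by (simp only: integral_mult_right_zero)
    finally show "cmod (pairing (R x) y) \<le> ?q * norm x * norm y" by simp
  qed
  \<comment> \<open>The equation \<open>x = z + d R z\<close> in fixed-point form.\<close>
  have "\<exists>!z. x - d *\<^sub>R R z = z"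
  proof (rule banach_fix_type)
    show "0 \<le> d * ?q" "d * ?q < 1" using d M_ge_1 \<mu> by (simp_all add: field_simps)
    have "norm ((x - d *\<^sub>R R v) - (x - d *\<^sub>R R w)) \<le> d * ?q * norm (v - w)" for v w
    proof -
      have "(x - d *\<^sub>R R v) - (x - d *\<^sub>R R w) = d *\<^sub>R (R (w - v))"
        by (simp add: R_diff[symmetric] algebra_simps)
      then show ?thesis
        using mult_left_mono[OF R_bound[of "w - v"], of d] d by (simp add: norm_minus_commute mult.assoc)
    qed
    then show "\<forall>v w. dist (x - d *\<^sub>R R v) (x - d *\<^sub>R R w) \<le> d * ?q * dist v w"
      by (simp add: dist_norm)
  qed
  then obtain z where "x - d *\<^sub>R R z = z" by blast
  then have z: "x = z + complex_of_real d *\<^sub>C R z" by (simp add: scaleC_of_real algebra_simps)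
  have "pairing (R z) y = (LINT t|half_line. ?e' t * pairing (S t x) y)" for y
  proof -
    have "(LINT t|half_line. ?e' t * pairing (S t x) y)
        = (LINT t|half_line. ?e' t * pairing (S t z) y + d * (?e' t * pairing (S t (R z)) y))"
      by (intro Bochner_Integration.integral_cong) (simp_all add: z S_simps left_simps algebra_simps)
    also have "\<dots> = (LINT t|half_line. ?e' t * pairing (S t z) y) + d * (LINT t|half_line. ?e' t * pairing (S t (R z)) y)"
      using \<mu> d(1) integrable_laplace[of "\<mu> + d"]
      by (subst Bochner_Integration.integral_add) (simp_all del: minus_add_distrib)
    \<comment> \<open>The transform of \<open>z\<close> at \<open>\<mu> + d\<close> cancels.\<close>
    also have "\<dots> = pairing (R z) y"
      using resolvent_identity[OF \<mu> d(1) R, of z y] d(1) by simp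
    finally show ?thesis ..
  qed
  then show "representable half_line (\<lambda>t. S t x) ?e'" unfolding representable_def by blast
qed

text \<open>The gap between the real part of the parameter and \<open>\<omega>\<close> only grows
  along the way, so one admissible step size serves for all \<open>k\<close>.\<close>

lemma laplace_steps:
  assumes \<mu>: "\<omega> < Re \<mu>" and lap: "laplace \<mu>" and d: "0 < d" "d * M < Re \<mu> - \<omega>"
  shows "laplace (\<mu> + complex_of_real (real k * d))"
proof (induction k)
  case (Suc k)
  have "0 \<le> real k * d" using d by simp
  then have "laplace (\<mu> + complex_of_real (real k * d) + complex_of_real d)"
    by (intro laplace_step[OF _ d(1) _ Suc]; use \<mu> d in \<open>simp only: Re_complex_of_real plus_complex.sel\<close>; linarith)
  then show ?case by (simp add: algebra_simps)
qed (simp add: lap)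

section \<open>Approximation: from exponentials to indicators\<close>

text \<open>In the variable \<open>s = exp (- d * t)\<close>, multiplying by the monomial
  \<open>s ^ k\<close> turns the exponential for \<open>\<mu>\<close> into the one for
  \<open>\<mu> + k d\<close>.\<close>

lemma representable_polynomial_exp:
  fixes g :: "real \<Rightarrow> complex"
  assumes \<mu>: "\<omega> < Re \<mu>" and d: "0 < d" and lap: "\<And>k::nat. laplace (\<mu> + complex_of_real (real k * d))"
    and g: "polynomial_function g"
  shows "representable half_line (\<lambda>t. S t x) (\<lambda>t. g (exp (- d * t)) * exp (- \<mu> * complex_of_real t))"
proof -
  let ?e = "\<lambda>k t. exp (- (\<mu> + complex_of_real (real k * d)) * complex_of_real t)"
  have rep: "representable half_line (\<lambda>t. S t x) (?e k)" for k
    using lap[of k] by (simp add: laplace_def)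
  have int: "integrable half_line (\<lambda>t. ?e k t * pairing (S t x) y)" for k y
  proof (rule integrable_laplace)
    show "\<omega> < Re (\<mu> + complex_of_real (real k * d))"
      using \<mu> mult_nonneg_nonneg[of "real k" d] d unfolding plus_complex.sel Re_complex_of_real by linarith
  qed
  \<comment> \<open>Coefficients are available for real polynomial functions, so real and imaginary
    parts are expanded separately.\<close>
  have "real_polynomial_function (Re \<circ> g)" "real_polynomial_function (Im \<circ> g)"
    using g bounded_linear_Re bounded_linear_Im by (auto simp: polynomial_function_def)
  then obtain a m b n where ab: "Re \<circ> g = (\<lambda>s. \<Sum>i\<le>m. a i * s ^ i)" "Im \<circ> g = (\<lambda>s. \<Sum>i\<le>n. b i * s ^ i)"
    unfolding real_polynomial_function_iff_sum by blast
  let ?P = "\<lambda>t. \<Sum>i\<le>m. complex_of_real (a i) * ?e i t"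
  let ?Q = "\<lambda>t. \<Sum>i\<le>n. complex_of_real (b i) * ?e i t"
  have "representable half_line (\<lambda>t. S t x) (\<lambda>t. ?P t + \<i> * ?Q t)"
  proof (rule representable_add)
    show "representable half_line (\<lambda>t. S t x) ?P" by (intro representable_sum rep int) simp
    show "representable half_line (\<lambda>t. S t x) (\<lambda>t. \<i> * ?Q t)"
      by (intro representable_cmult representable_sum rep int) simp
    show "integrable half_line (\<lambda>t. ?P t * pairing (S t x) y)" for y
      unfolding sum_distrib_right mult.assoc[of "complex_of_real _"]
      by (intro Bochner_Integration.integrable_sum integrable_mult_right int)
    show "integrable half_line (\<lambda>t. \<i> * ?Q t * pairing (S t x) y)" for y
      unfolding sum_distrib_right mult.assoc[of \<i>] mult.assoc[of "complex_of_real _"]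
      by (intro Bochner_Integration.integrable_sum integrable_mult_right int)
  qed
  moreover have "?P t + \<i> * ?Q t = g (exp (- d * t)) * exp (- \<mu> * complex_of_real t)" for t
  proof -
    have e: "?e k t = complex_of_real (exp (- d * t) ^ k) * exp (- \<mu> * complex_of_real t)" for k
      by (simp add: exp_of_real[symmetric] exp_of_nat_mult[symmetric] exp_add[symmetric] algebra_simps)
    have "g s = complex_of_real (\<Sum>i\<le>m. a i * s ^ i) + \<i> * complex_of_real (\<Sum>i\<le>n. b i * s ^ i)" for s
      using fun_cong[OF ab(1), of s] fun_cong[OF ab(2), of s] complex_eq[of "g s"] by simp
    then show ?thesis
      unfolding e by (simp add: distrib_right sum_distrib_right mult.assoc)
  qed
  ultimately show ?thesis by simp
qed

text \<open>The substitution \<open>s = exp (- d * t)\<close> maps the half line into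
  \<open>{0..1}\<close>, where Weierstrass approximation applies to \<open>q\<close>. The factor
  \<open>exp (- \<mu> * t)\<close> split off from \<open>k\<close> provides the decay that dominates
  the approximants.\<close>

lemma representable_compact_support:
  fixes k :: "real \<Rightarrow> complex"
  assumes \<mu>: "\<omega> < Re \<mu>" and lap: "laplace \<mu>"
    and k: "continuous_on UNIV k" and supp: "\<And>t. b \<le> t \<Longrightarrow> k t = 0" and b: "0 \<le> b"
  shows "representable half_line (\<lambda>t. S t x) k"
proof -
  \<comment> \<open>Half the step size at which the contraction argument would break down.\<close>
  define d where "d = (Re \<mu> - \<omega>) / (2 * M)"
  have d: "0 < d" "d * M < Re \<mu> - \<omega>" using \<mu> M_ge_1 by (simp_all add: d_def field_simps)
  \<comment> \<open>\<open>v\<close> inverts the substitution. Cutting its argument off at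
    \<open>c\<close>, the image of \<open>b\<close>, avoids the singularity of the logarithm at 0;
    below \<open>c\<close> it returns \<open>b\<close>, where \<open>k\<close> vanishes.\<close>
  define c where "c = exp (- d * b)"
  define v where "v s = - ln (max s c) / d" for s :: real
  define q where "q s = k (v s) * exp (\<mu> * complex_of_real (v s))" for s
  have c: "0 < c" by (simp add: c_def)
  have "continuous_on {0..1} v"
    unfolding v_def using c d(1) by (intro continuous_intros) auto
  then have q: "continuous_on {0..1} q"
    unfolding q_def by (intro continuous_intros continuous_on_compose2[OF k]) auto
  have qk: "q (exp (- d * t)) * exp (- \<mu> * complex_of_real t) = k t" for t
  proof (cases "t \<le> b")
    case True
    then have "v (exp (- d * t)) = t"
      using d(1) by (simp add: v_def c_def max_absorb1)
    then show ?thesis by (simp add: q_def exp_minus)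
  next
    case False
    then have "v (exp (- d * t)) = b"
      using d(1) by (simp add: v_def c_def max_absorb2)
    then show ?thesis using False supp[of b] supp[of t] by (simp add: q_def)
  qed
  have "\<exists>g. polynomial_function g \<and> (\<forall>s\<in>{0..1}. norm (q s - g s) < 1 / Suc n)" for n
    using Stone_Weierstrass_polynomial_function[OF compact_Icc q, of "1 / Suc n"] by auto
  then obtain g where g: "\<And>n. polynomial_function (g n)" "\<And>n s. s \<in> {0..1} \<Longrightarrow> norm (q s - g n s) < 1 / Suc n"
    by metis
  obtain B where B: "\<And>s. s \<in> {0..1} \<Longrightarrow> norm (q s) \<le> B"
    using compact_imp_bounded[OF compact_continuous_image[OF q compact_Icc]] by (force simp: bounded_iff)
  have exp_mem: "exp (- d * t) \<in> {0..1}" if "0 \<le> t" for t using that d(1) by simp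
  let ?f = "\<lambda>n t. g n (exp (- d * t)) * exp (- \<mu> * complex_of_real t)"
  show ?thesis
  proof (rule representable_orbit_limit[where f = ?f, OF _ _ \<mu>])
    show "?f n \<in> borel_measurable half_line" for n
      by (intro measurable_continuous_half_line continuous_intros
          continuous_on_compose2[OF continuous_on_polymonial_function[OF g(1)[of n]]]) auto
    show "k \<in> borel_measurable half_line" using k by (rule measurable_continuous_half_line)
    \<comment> \<open>The extra 1 covers the approximation error \<open>1 / Suc n\<close>.\<close>
    show "cmod (?f n t) \<le> (B + 1) * exp (- Re \<mu> * t)" if "0 \<le> t" for n t
    proof -
      have "1 / real (Suc n) \<le> 1" by simp
      with g(2)[OF exp_mem[OF that], of n] B[OF exp_mem[OF that]]
      have "cmod (g n (exp (- d * t))) \<le> B + 1"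
        using norm_triangle_sub[of "g n (exp (- d * t))" "q (exp (- d * t))"]
        by (simp only: norm_minus_commute[of "g n _"])
      then show ?thesis by (simp add: norm_mult)
    qed
    show "AE t in half_line. (\<lambda>n. ?f n t) \<longlonglongrightarrow> k t"
    proof (rule AE_I2)
      fix t assume "t \<in> space half_line"
      then have t: "exp (- d * t) \<in> {0..1}" by (intro exp_mem) simp
      have "(\<lambda>n. g n (exp (- d * t))) \<longlonglongrightarrow> q (exp (- d * t))"
      proof (rule metric_tendsto_imp_tendsto[where a = "0 :: real"])
        show "(\<lambda>n. 1 / real (Suc n)) \<longlonglongrightarrow> 0" using LIMSEQ_inverse_real_of_nat by (simp add: inverse_eq_divide)
        show "\<forall>\<^sub>F n in sequentially. dist (g n (exp (- d * t))) (q (exp (- d * t))) \<le> dist (1 / real (Suc n)) 0"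
          using g(2)[OF t] by (intro always_eventually allI) (simp add: dist_norm norm_minus_commute less_imp_le)
      qed
      then have "(\<lambda>n. ?f n t) \<longlonglongrightarrow> q (exp (- d * t)) * exp (- \<mu> * complex_of_real t)"
        by (rule tendsto_mult_right)
      then show "(\<lambda>n. ?f n t) \<longlonglongrightarrow> k t" by (simp only: qk)
    qed
    show "representable half_line (\<lambda>t. S t x) (?f n)" for n
      using \<mu> d g(1) laplace_steps[OF \<mu> lap d] by (intro representable_polynomial_exp) auto
  qed
qed

text \<open>Puts weights of bounded support under the exponential majorant required by
  \<open>representable_orbit_limit\<close>; the rate \<open>\<bar>\<omega>\<bar> + 1\<close> is
  positive and exceeds \<open>\<omega>\<close>.\<close>

lemma cutoff_bound: "\<exists>C. \<forall>t\<ge>0. indicat_real {..b} t \<le> C * exp (- (\<bar>\<omega>\<bar> + 1) * t)"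
proof (intro exI[of _ "exp ((\<bar>\<omega>\<bar> + 1) * b)"] allI impI)
  fix t :: real assume "0 \<le> t"
  show "indicat_real {..b} t \<le> exp ((\<bar>\<omega>\<bar> + 1) * b) * exp (- (\<bar>\<omega>\<bar> + 1) * t)"
  proof (cases "t \<le> b")
    case True
    then have "0 \<le> (\<bar>\<omega>\<bar> + 1) * (b - t)" by simp
    then have "0 \<le> (\<bar>\<omega>\<bar> + 1) * b + - (\<bar>\<omega>\<bar> + 1) * t" by (simp add: algebra_simps)
    then show ?thesis using True unfolding exp_add[symmetric] by simp
  qed simp
qed

lemma measurable_indicator_half_line:
  assumes "A \<in> sets lebesgue"
  shows "(\<lambda>t. complex_of_real (indicator A t)) \<in> borel_measurable half_line"
  using measurable_compose[OF borel_measurable_indicator[OF assms] borel_measurable_of_real]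
  by (rule measurable_restrict_space1)

text \<open>By measurability the indicator is an almost everywhere limit of continuous functions,
  which are cut down to bounded values and bounded support.\<close>

lemma representable_indicator:
  assumes \<mu>: "\<omega> < Re \<mu>" and lap: "laplace \<mu>"
    and A: "A \<in> sets lebesgue" "A \<subseteq> {0..b}"
  shows "representable half_line (\<lambda>t. S t x) (\<lambda>t. complex_of_real (indicator A t))"
proof (cases "0 \<le> b")
  case False
  then have "A = {}" using A(2) by auto
  then show ?thesis using representable_sum[of "{}"] by simp
next
  case b: True
  have "indicat_real A measurable_on UNIV"
    using A(1) by (intro lebesgue_measurable_imp_measurable_on) auto
  then obtain Z g where Z: "negligible Z" and g: "\<And>n. continuous_on UNIV (g n)"
    and lim: "\<And>t. t \<notin> Z \<Longrightarrow> (\<lambda>n. g n t) \<longlonglongrightarrow> indicat_real A t"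
    unfolding measurable_on_def by auto
  \<comment> \<open>Clamping to \<open>{0..1}\<close> gives domination. The ramp is 1 up to
    \<open>b\<close> and 0 from \<open>b + 1\<close> on, so it leaves the limit, which lives on
    \<open>{0..b}\<close>, unchanged.\<close>
  define k where "k n t = max 0 (min 1 (g n t)) * max 0 (min 1 (b + 1 - t))" for n t
  have k_cont: "continuous_on UNIV (\<lambda>t. complex_of_real (k n t))" for n
    unfolding k_def by (intro continuous_intros g)
  have k_le: "0 \<le> k n t" "k n t \<le> indicator {..b + 1} t" for n t
    using mult_mono[of "max 0 (min 1 (g n t))" 1 "max 0 (min 1 (b + 1 - t))" 1]
    by (auto simp: k_def indicator_def max_def min_def)
  obtain C where C: "\<And>t. 0 \<le> t \<Longrightarrow> indicat_real {..b + 1} t \<le> C * exp (- (\<bar>\<omega>\<bar> + 1) * t)"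
    using cutoff_bound by blast
  have "\<omega> < \<bar>\<omega>\<bar> + 1" by simp
  then show ?thesis
  proof (rule representable_orbit_limit[rotated 2])
    show "(\<lambda>t. complex_of_real (k n t)) \<in> borel_measurable half_line" for n
      using k_cont by (rule measurable_continuous_half_line)
    show "(\<lambda>t. complex_of_real (indicator A t)) \<in> borel_measurable half_line"
      using A(1) by (rule measurable_indicator_half_line)
    show "cmod (complex_of_real (k n t)) \<le> C * exp (- (\<bar>\<omega>\<bar> + 1) * t)" if "0 \<le> t" for n t
      using k_le[of n t] C[OF that] by simp
    have "AE t in lebesgue. t \<notin> Z"
      using Z by (intro AE_not_in) (simp add: negligible_iff_null_sets)
    then have "AE t in half_line. t \<notin> Z"
      by (simp add: AE_restrict_space_iff) (auto elim: eventually_mono)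
    then show "AE t in half_line. (\<lambda>n. complex_of_real (k n t)) \<longlonglongrightarrow> complex_of_real (indicator A t)"
    proof eventually_elim
      case (elim t)
      have "(\<lambda>n. k n t) \<longlonglongrightarrow> max 0 (min 1 (indicator A t)) * max 0 (min 1 (b + 1 - t))"
        unfolding k_def by (intro tendsto_intros lim elim)
      also have "max 0 (min 1 (indicator A t)) * max 0 (min 1 (b + 1 - t)) = indicat_real A t"
        using A(2) by (auto simp: indicator_def min_def)
      finally show ?case by (rule tendsto_of_real)
    qed
    show "representable half_line (\<lambda>t. S t x) (\<lambda>t. complex_of_real (k n t))" for n
      by (rule representable_compact_support[OF \<mu> lap k_cont, of "b + 1"]) (use b in \<open>auto simp: k_def\<close>)
  qed
qed

text \<open>A measurable subset of a bounded interval is bounded, so the weak integral over it is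
  the case of an indicator weight.\<close>

lemma locally_pair_integrable_orbit:
  assumes \<mu>: "\<omega> < Re \<mu>" and lap: "laplace \<mu>"
  shows "locally_pair_integrable pairing (\<lambda>t. S t x)"
  unfolding locally_pair_integrable_def
proof (intro allI impI, elim conjE)
  fix J :: "real set" assume J: "is_interval J" "bounded J" "J \<subseteq> {0..}"
  have J_sets: "J \<in> sets lebesgue"
    using J by (intro fmeasurableD measurable_convex is_interval_convex)
  obtain b where "\<And>t. t \<in> J \<Longrightarrow> \<bar>t\<bar> \<le> b" using J(2) by (auto simp: bounded_iff)
  then have Jb: "J \<subseteq> {0..b}" using J(3) by force
  obtain C where C: "\<And>t. 0 \<le> t \<Longrightarrow> indicat_real {..b} t \<le> C * exp (- (\<bar>\<omega>\<bar> + 1) * t)"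
    using cutoff_bound by blast
  show "pair_integrable pairing (lebesgue_on J) (\<lambda>t. S t x)"
    unfolding pair_integrable_def scalarly_integrable_def
  proof (intro conjI allI ballI)
    fix y
    have "integrable half_line (\<lambda>t. complex_of_real (indicator J t) * pairing (S t x) y)"
    proof (rule integrable_orbit)
      show "(\<lambda>t. complex_of_real (indicator J t)) \<in> borel_measurable half_line"
        using J_sets by (rule measurable_indicator_half_line)
      show "cmod (complex_of_real (indicator J t)) \<le> C * exp (- (\<bar>\<omega>\<bar> + 1) * t)" if "0 \<le> t" for t
      proof -
        have "indicat_real J t \<le> indicat_real {..b} t"
          using Jb by (auto simp: indicator_def)
        then show ?thesis using C[OF that] by simp
      qed
    qed simp
    then show "integrable (lebesgue_on J) (\<lambda>t. pairing (S t x) y)"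
      unfolding integral_half_line_restrict(2)[OF J_sets J(3)] by (simp add: scaleR_conv_of_real)
  next
    fix A assume "A \<in> sets (lebesgue_on J)"
    then have A: "A \<in> sets lebesgue" "A \<subseteq> J" using J_sets by (auto simp: sets_restrict_space_iff)
    then obtain u where u: "\<And>y. pairing u y = (LINT t|half_line. complex_of_real (indicator A t) * pairing (S t x) y)"
      using representable_indicator[OF \<mu> lap, of A b x] Jb unfolding representable_def by blast
    have "pairing u y = weak_integral pairing (lebesgue_on J) A (\<lambda>t. S t x) y" for y
      unfolding weak_integral_def set_lebesgue_integral_def u integral_half_line_restrict(1)[OF J_sets J(3)]
      using A(2) by (intro Bochner_Integration.integral_cong) (auto simp: indicator_def)
    then show "weak_integral pairing (lebesgue_on J) A (\<lambda>t. S t x) \<in> range pairing" by (metis ext rangeI)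
  qed
qed

end

section \<open>The two implications\<close>

text \<open>Truncations to \<open>{0..real n}\<close> converge pointwise. This supplies the
  measurability required for interpreting \<open>dual_semigroup\<close>.\<close>

lemma measurable_half_line_of_local:
  assumes "locally_pair_integrable p F"
  shows "(\<lambda>t. p (F t) y) \<in> borel_measurable half_line"
proof (rule borel_measurable_LIMSEQ_metric)
  show "(\<lambda>t. indicat_real {0..real n} t *\<^sub>R p (F t) y) \<in> borel_measurable half_line" for n
  proof -
    have "pair_integrable p (lebesgue_on {0..real n}) F"
      using assms by (simp add: locally_pair_integrable_def is_interval_cc)
    then have "integrable (lebesgue_on {0..real n}) (\<lambda>t. p (F t) y)"
      by (simp add: pair_integrable_def scalarly_integrable_def)
    then have "integrable half_line (\<lambda>t. indicat_real {0..real n} t *\<^sub>R p (F t) y)"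
      by (subst (asm) integral_half_line_restrict(2)) auto
    then show ?thesis by (rule borel_measurable_integrable)
  qed
  fix t assume "t \<in> space half_line"
  moreover obtain m :: nat where "t \<le> real m" using real_arch_simple by blast
  ultimately have "\<forall>\<^sub>F n in sequentially. indicat_real {0..real n} t *\<^sub>R p (F t) y = p (F t) y"
    by (intro eventually_sequentiallyI[of m]) auto
  then show "(\<lambda>n. indicat_real {0..real n} t *\<^sub>R p (F t) y) \<longlonglongrightarrow> p (F t) y" by (rule tendsto_eventually)
qed

theorem theorem5p8:
  fixes pairing :: "'a::complex_banach \<Rightarrow> 'b::complex_banach \<Rightarrow> complex"
    and T :: "real \<Rightarrow> 'a \<Rightarrow> 'a"
    and M \<omega> :: real
  assumes "norming_dual_pair pairing"
    and "semigroup_of_type pairing M \<omega> T"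
  shows "integrable_semigroup pairing \<omega> T \<longleftrightarrow>
    (\<forall>x. locally_pair_integrable pairing (\<lambda>t. T t x)) \<and>
    (\<forall>y. locally_pair_integrable (flip pairing) (\<lambda>t. sigma_adjoint pairing (T t) y))"
    (is "?integrable \<longleftrightarrow> ?local")
proof -
  interpret norming_dual_pair pairing by fact
  let ?T' = "\<lambda>t. sigma_adjoint pairing (T t)"
  \<comment> \<open>The type of the semigroup yields everything but the measurability of the orbits,
    which each direction obtains in its own way.\<close>
  have dual: "dual_semigroup pairing T ?T' M \<omega>"
    if meas: "\<And>x y. (\<lambda>t. pairing (T t x) y) \<in> borel_measurable half_line"
  proof unfold_locales
    fix t x assume t: "0 \<le> (t::real)"
    show "pairing (T t x) y = pairing x (?T' t y)" for y
      using t assms(2) by (intro sigma_adjoint_eq) (simp add: semigroup_of_type_def semigroup_on_def)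
    show "T (t + s) x = T t (T s x)" if "0 \<le> s" for s
      using t that assms(2) by (simp add: semigroup_of_type_def semigroup_on_def)
    have "bounded_linear (T t)" "onorm (T t) \<le> M * exp (\<omega> * t)"
      using t assms(2) by (simp_all add: semigroup_of_type_def)
    then show "norm (T t x) \<le> M * exp (\<omega> * t) * norm x"
      by (meson mult_right_mono norm_ge_zero onorm order_trans)
  qed (use meas assms(2) in \<open>simp_all add: semigroup_of_type_def\<close>)
  show ?thesis
  proof
    assume ?integrable
    then obtain \<mu> R where meas: "\<And>x y. (\<lambda>t. pairing (T t x) y) \<in> borel_measurable half_line"
      and \<mu>: "Re \<mu> > \<omega>" and R: "R \<in> sigma_operators pairing"
      "\<And>x y. pairing (R x) y = (LINT t|half_line. exp (- \<mu> * complex_of_real t) * pairing (T t x) y)"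
      unfolding integrable_semigroup_def by blast
    interpret dual_semigroup pairing T ?T' M \<omega> by (rule dual[OF meas])
    interpret flip: dual_semigroup "flip pairing" ?T' T M \<omega> by (rule flip_dual_semigroup)
    have "laplace \<mu>" using R(2) unfolding laplace_def representable_def by blast
    \<comment> \<open>The \<sigma>-adjoint of \<open>R\<close> is the Laplace transform of the
      adjoint semigroup and serves as the witness.\<close>
    moreover have "flip.laplace \<mu>"
      unfolding flip.laplace_def flip.representable_def
    proof (intro allI exI)
      fix x y
      have "pairing x (sigma_adjoint pairing R y) = pairing (R x) y"
        using sigma_adjoint_eq[OF R(1)] by simp
      also have "\<dots> = (LINT t|half_line. exp (- \<mu> * complex_of_real t) * pairing x (?T' t y))"
        unfolding R(2) by (intro Bochner_Integration.integral_cong) (simp_all add: adjoint)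
      finally show "pairing x (sigma_adjoint pairing R y)
        = (LINT t|half_line. exp (- \<mu> * complex_of_real t) * pairing x (?T' t y))" .
    qed
    ultimately show ?local
      using \<mu> locally_pair_integrable_orbit flip.locally_pair_integrable_orbit by blast
  next
    assume loc: ?local
    then have meas: "(\<lambda>t. pairing (T t x) y) \<in> borel_measurable half_line" for x y
      by (intro measurable_half_line_of_local[where p = pairing]) simp
    interpret dual_semigroup pairing T ?T' M \<omega> by (rule dual[OF meas])
    interpret flip: dual_semigroup "flip pairing" ?T' T M \<omega> by (rule flip_dual_semigroup)
    define \<mu> where "\<mu> = complex_of_real (\<omega> + 1)"
    have \<mu>: "\<omega> < Re \<mu>" by (simp add: \<mu>_def)
    have "\<exists>u. \<forall>y. pairing u y = (LINT t|half_line. exp (- \<mu> * complex_of_real t) * pairing (T t x) y)" for x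
      using representable_exp_of_locally_integrable[OF _ \<mu>, of x] loc unfolding representable_def by blast
    then obtain R where R: "\<And>x y. pairing (R x) y
        = (LINT t|half_line. exp (- \<mu> * complex_of_real t) * pairing (T t x) y)" by metis
    have "\<exists>v. \<forall>x. pairing x v = (LINT t|half_line. exp (- \<mu> * complex_of_real t) * pairing x (?T' t y))" for y
      using flip.representable_exp_of_locally_integrable[OF _ \<mu>, of y] loc unfolding flip.representable_def by blast
    then obtain R' where R': "\<And>x y. pairing x (R' y)
        = (LINT t|half_line. exp (- \<mu> * complex_of_real t) * pairing x (?T' t y))" by metis
    \<comment> \<open>The integrands agree pointwise, so the two transforms are adjoint to each
      other, which amounts to \<sigma>-continuity of \<open>R\<close>.\<close>
    have "pairing (R x) y = pairing x (R' y)" for x y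
      unfolding R R' by (intro Bochner_Integration.integral_cong) (simp_all add: adjoint)
    then have "R \<in> sigma_operators pairing" unfolding sigma_operator_iff by blast
    with meas \<mu> R show ?integrable unfolding integrable_semigroup_def by blast
  qed
qed

end
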